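(* Let $G$ be a connected graph. Then every total mutual-visibility set of $G$ is independent if and only if for every edge $uv\in E(G)$ at least one of the following holds: (a) $u$ or $v$ is the middle vertex of a convex $P_3$; (b) $uv$ is the middle edge of a convex diamond.
   Context: All graphs are finite and simple. For $X\subseteq V(G)$, two vertices $u,v$ are $X$-visible if there is a shortest $u,v$-path $P$ with $V(P)\cap X\subseteq\{u,v\}$; $X$ is a total mutual-visibility set if any two vertices of $V(G)$ are $X$-visible. A convex $P_3$ is a path $xyz$ with $xz\notin E(G)$ and $N(x)\cap N(z)=\{y\}$; $y$ is its middle vertex. A diamond is $K_4$ minus an edge. A convex diamond $v_1v_2v_3v_4$ is a diamond subgraph in which $v_1,v_3$ are nonadjacent and $N(v_1)\cap N(v_3)=\{v_2,v_4\}$; the edge $v_2v_4$ is its middle edge. *)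

theory Defs
  imports
    "Graph_Theory.Pair_Digraph"
    "Graph_Theory.Digraph_Component"
    "Graph_Theory.Vertex_Walk"
begin

text \<open>A finite simple graph is a \<^locale>\<open>pair_graph\<close>: finite vertex set, and a symmetric
  irreflexive arc relation, so an undirected edge uv is represented by both (u,v) and (v,u).\<close>

definition neighborhood :: "'a pair_pre_digraph \<Rightarrow> 'a \<Rightarrow> 'a set" where
  "neighborhood G v = {w. (v, w) \<in> parcs G}"

definition independent_set :: "'a pair_pre_digraph \<Rightarrow> 'a set \<Rightarrow> bool" where
  "independent_set G X \<longleftrightarrow>
     X \<subseteq> pverts G \<and> (\<forall>u \<in> X. \<forall>v \<in> X. (u, v) \<notin> parcs G)"

definition path_between :: "'a pair_pre_digraph \<Rightarrow> 'a \<Rightarrow> 'a list \<Rightarrow> 'a \<Rightarrow> bool" where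
  "path_between G u p v \<longleftrightarrow> vpath p (with_proj G) \<and> hd p = u \<and> last p = v"

definition shortest_path :: "'a pair_pre_digraph \<Rightarrow> 'a \<Rightarrow> 'a list \<Rightarrow> 'a \<Rightarrow> bool" where
  "shortest_path G u p v \<longleftrightarrow>
     path_between G u p v \<and>
     (\<forall>q. path_between G u q v \<longrightarrow> vwalk_length p \<le> vwalk_length q)"

definition visible :: "'a pair_pre_digraph \<Rightarrow> 'a set \<Rightarrow> 'a \<Rightarrow> 'a \<Rightarrow> bool" where
  "visible G X u v \<longleftrightarrow> (\<exists>p. shortest_path G u p v \<and> set p \<inter> X \<subseteq> {u, v})"

definition total_mutual_visibility_set :: "'a pair_pre_digraph \<Rightarrow> 'a set \<Rightarrow> bool" where
  "total_mutual_visibility_set G X \<longleftrightarrow>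
     X \<subseteq> pverts G \<and> (\<forall>u \<in> pverts G. \<forall>v \<in> pverts G. visible G X u v)"

definition convex_P3 :: "'a pair_pre_digraph \<Rightarrow> 'a \<Rightarrow> 'a \<Rightarrow> 'a \<Rightarrow> bool" where
  "convex_P3 G x y z \<longleftrightarrow>
     vpath [x, y, z] (with_proj G) \<and> (x, z) \<notin> parcs G \<and>
     neighborhood G x \<inter> neighborhood G z = {y}"

definition middle_vertex_of_convex_P3 :: "'a pair_pre_digraph \<Rightarrow> 'a \<Rightarrow> bool" where
  "middle_vertex_of_convex_P3 G y \<longleftrightarrow> (\<exists>x z. convex_P3 G x y z)"

text \<open>The diamond on v1, v2, v3, v4 is the complete graph on these vertices minus the edge v1v3.
  As a subgraph of G it need not be induced, so v1v3 may or may not be an edge of G.\<close>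

definition diamond_subgraph :: "'a pair_pre_digraph \<Rightarrow> 'a \<Rightarrow> 'a \<Rightarrow> 'a \<Rightarrow> 'a \<Rightarrow> bool" where
  "diamond_subgraph G v1 v2 v3 v4 \<longleftrightarrow>
     distinct [v1, v2, v3, v4] \<and>
     {(v1, v2), (v2, v3), (v3, v4), (v4, v1), (v2, v4)} \<subseteq> parcs G"

definition convex_diamond :: "'a pair_pre_digraph \<Rightarrow> 'a \<Rightarrow> 'a \<Rightarrow> 'a \<Rightarrow> 'a \<Rightarrow> bool" where
  "convex_diamond G v1 v2 v3 v4 \<longleftrightarrow>
     diamond_subgraph G v1 v2 v3 v4 \<and> (v1, v3) \<notin> parcs G \<and>
     neighborhood G v1 \<inter> neighborhood G v3 = {v2, v4}"

definition middle_edge_of_convex_diamond :: "'a pair_pre_digraph \<Rightarrow> 'a \<Rightarrow> 'a \<Rightarrow> bool" where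
  "middle_edge_of_convex_diamond G u v \<longleftrightarrow>
     (\<exists>v1 v2 v3 v4. convex_diamond G v1 v2 v3 v4 \<and> {u, v} = {v2, v4})"

end

theory Submission
  imports Defs
begin

text \<open>
  In a connected graph, total mutual-visibility is decided by the pairs of vertices at distance two:
  a shortest path with an inner vertex \<open>b \<in> X\<close> between \<open>a\<close> and \<open>c\<close> can be rerouted through a common
  neighbour of \<open>a\<close> and \<open>c\<close> outside \<open>X\<close>. For \<open>X = {u, v}\<close> with \<open>uv\<close> an edge, such a common
  neighbour fails to exist exactly when \<open>N(a) \<inter> N(c)\<close> is \<open>{u}\<close>, \<open>{v}\<close> or \<open>{u, v}\<close>,
  which gives a convex \<open>P\<^sub>3\<close> or a convex diamond.
\<close>

lemma vwalk_append_iff: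
  assumes "p \<noteq> []" "q \<noteq> []"
  shows "vwalk (p @ q) G \<longleftrightarrow> vwalk p G \<and> vwalk q G \<and> (last p, hd q) \<in> arcs_ends G"
  using assms by (auto simp: vwalk_def vwalk_arcs_append)

lemma length_vwalk_to_vpath_le: "length (vwalk_to_vpath p) \<le> length p"
proof (induct p rule: vwalk_to_vpath_induct3)
  case (in_set x xs)
  then show ?case
    using length_dropWhile_le[of "\<lambda>y. y \<noteq> x" xs] by simp
qed auto

text \<open>When the head \<open>x\<close> recurs in \<open>xs\<close>, the conversion restarts at
  the first recurrence, so at least that head is lost.\<close>

lemma length_vwalk_to_vpath_less:
  "\<not> distinct p \<Longrightarrow> length (vwalk_to_vpath p) < length p"
proof (induct p rule: vwalk_to_vpath_induct3)
  case (in_set x xs)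
  then show ?case
    using length_dropWhile_le[of "\<lambda>y. y \<noteq> x" xs]
      length_vwalk_to_vpath_le[of "dropWhile (\<lambda>y. y \<noteq> x) xs"] by simp
qed auto

lemma path_between_vwalk_to_vpath:
  assumes "vwalk q (with_proj G)"
  shows "path_between G (hd q) (vwalk_to_vpath q) (last q)"
  using assms
  by (simp add: path_between_def vwalk_to_vpath_hd vwalk_to_vpath_last vwalk_to_vpath_vpath)

lemma path_between_nonempty: "path_between G u p v \<Longrightarrow> p \<noteq> []"
  by (auto simp: path_between_def)

text \<open>\<open>shortest_path\<close> minimises over paths only. Cutting the cycles out of a walk
  extends the bound to all walks, so later comparisons need no distinctness check.\<close>

lemma shortest_path_length_le_vwalk:
  assumes "shortest_path G u p v" "vwalk q (with_proj G)" "hd q = u" "last q = v"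
  shows "length p \<le> length q"
proof -
  have "path_between G u (vwalk_to_vpath q) v"
    using path_between_vwalk_to_vpath[OF assms(2)] assms(3,4) by simp
  \<comment> \<open>\<open>vwalk_length\<close> is list length minus one with truncated subtraction,
    so both lists must be known nonempty before the lengths themselves can be compared.\<close>
  with assms(1) have "length p - 1 \<le> length (vwalk_to_vpath q) - 1"
    and "p \<noteq> []" "vwalk_to_vpath q \<noteq> []"
    using path_between_nonempty by (fastforce simp: shortest_path_def)+
  then show ?thesis
    using length_vwalk_to_vpath_le[of q] by (cases p; cases "vwalk_to_vpath q") auto
qed

text \<open>A repeated vertex in \<open>q\<close> could be cut out, leaving a path shorter than
  \<open>p\<close>; hence \<open>q\<close> is automatically a path.\<close>

lemma shortest_path_vwalkI:
  assumes p: "shortest_path G u p v"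
    and q: "vwalk q (with_proj G)" "hd q = u" "last q = v" "length q \<le> length p"
  shows "shortest_path G u q v"
proof -
  have "distinct q"
  proof (rule ccontr)
    assume "\<not> distinct q"
    then have "length (vwalk_to_vpath q) < length p"
      using length_vwalk_to_vpath_less q(4) by fastforce
    moreover have "length p \<le> length (vwalk_to_vpath q)"
      using p path_between_vwalk_to_vpath[OF q(1)] q(2,3)
      by (intro shortest_path_length_le_vwalk[OF p]) (auto simp: path_between_def)
    ultimately show False by simp
  qed
  then have "path_between G u q v"
    using q by (auto simp: path_between_def)
  moreover have "vwalk_length q \<le> vwalk_length r" if "path_between G u r v" for r
    using that p q(4) by (fastforce simp: shortest_path_def)
  ultimately show ?thesis by (simp add: shortest_path_def)
qed

text \<open>\<open>connected\<close> refers to the symmetrised digraph; symmetry of the arcs turns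
  it into reachability in the graph itself.\<close>

lemma (in pair_graph) ex_shortest_path:
  assumes "Digraph_Component.connected (with_proj G)" "u \<in> pverts G" "v \<in> pverts G"
  shows "\<exists>p. shortest_path G u p v"
proof -
  have "strongly_connected (with_proj G)"
    using assms(1) sym_arcs by (rule symmetric_connected_imp_strongly_connected[rotated])
  then have "u \<rightarrow>\<^sup>*\<^bsub>with_proj G\<^esub> v"
    using assms(2,3) by auto
  then obtain p where "path_between G u p v"
    unfolding path_between_def using reachable_vpath_conv by blast
  then show ?thesis
    unfolding shortest_path_def by (rule ex_has_least_nat)
qed

lemma (in pair_graph) total_mutual_visibility_set_iff:
  assumes conn: "Digraph_Component.connected (with_proj G)"
  shows "total_mutual_visibility_set G X \<longleftrightarrow>
    X \<subseteq> pverts G \<and>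
    (\<forall>a b c. (a, b) \<in> parcs G \<longrightarrow> (b, c) \<in> parcs G \<longrightarrow> a \<noteq> c \<longrightarrow> (a, c) \<notin> parcs G \<longrightarrow>
      (\<exists>w. (a, w) \<in> parcs G \<and> (w, c) \<in> parcs G \<and> w \<notin> X))"
    (is "_ \<longleftrightarrow> _ \<and> ?local")
proof (intro iffI conjI)
  assume vis: "total_mutual_visibility_set G X"
  then show "X \<subseteq> pverts G" by (simp add: total_mutual_visibility_set_def)
  show ?local
  proof (intro allI impI)
    fix a b c
    assume abc: "(a, b) \<in> parcs G" "(b, c) \<in> parcs G" "a \<noteq> c" "(a, c) \<notin> parcs G"
    then have verts: "a \<in> pverts G" "b \<in> pverts G" "c \<in> pverts G"
      using in_arcsD1 in_arcsD2 by blast+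
    with vis obtain p where p: "shortest_path G a p c" "set p \<inter> X \<subseteq> {a, c}"
      unfolding total_mutual_visibility_set_def visible_def by blast
    have path: "vwalk p (with_proj G)" "distinct p" "hd p = a" "last p = c" "p \<noteq> []"
      using p(1) by (auto simp: shortest_path_def path_between_def)
    \<comment> \<open>The walk through \<open>b\<close> bounds \<open>p\<close> by three vertices;
      \<open>a \<noteq> c\<close> and the missing arc from \<open>a\<close> to \<open>c\<close> rule
      out fewer.\<close>
    have "length p \<le> length [a, b, c]"
      using abc verts by (intro shortest_path_length_le_vwalk[OF p(1)]) auto
    with path abc(3,4) obtain w where w: "p = [a, w, c]"
      by (cases p; cases "tl p"; cases "tl (tl p)") (auto split: if_splits)
    then show "\<exists>w. (a, w) \<in> parcs G \<and> (w, c) \<in> parcs G \<and> w \<notin> X"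
      using path p(2) by auto
  qed
next
  assume "X \<subseteq> pverts G \<and> ?local"
  then have sub: "X \<subseteq> pverts G" and local: ?local by blast+
  have "visible G X u v" if uv: "u \<in> pverts G" "v \<in> pverts G" for u v
  proof -
    \<comment> \<open>Among all shortest paths, take one with the fewest vertices in
      \<open>X\<close>. A single rerouting that lowers this count then gives a
      contradiction.\<close>
    let ?hits = "\<lambda>p. length (filter (\<lambda>x. x \<in> X) p)"
    obtain p0 where "shortest_path G u p0 v"
      using ex_shortest_path[OF conn uv] by blast
    then obtain p where p: "shortest_path G u p v"
      and min: "\<And>q. shortest_path G u q v \<Longrightarrow> ?hits p \<le> ?hits q"
      using ex_has_least_nat[of "\<lambda>p. shortest_path G u p v" p0 ?hits] by blast
    have path: "vwalk p (with_proj G)" "distinct p" "hd p = u" "last p = v"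
      using p by (auto simp: shortest_path_def path_between_def)
    have "b \<in> {u, v}" if b: "b \<in> set p" "b \<in> X" for b
    proof (rule ccontr)
      assume nb: "b \<notin> {u, v}"
      obtain ps qs where split: "p = ps @ b # qs" using b(1) split_list by fast
      with nb path have "ps \<noteq> []" "qs \<noteq> []" by auto
      then obtain as a c cs where "ps = as @ [a]" "qs = c # cs"
        by (metis list.exhaust rev_exhaust)
      with split have p_eq: "p = (as @ [a]) @ [b] @ c # cs" by simp
      have walk: "vwalk (as @ [a]) (with_proj G)" "vwalk (c # cs) (with_proj G)"
        "(a, b) \<in> parcs G" "(b, c) \<in> parcs G"
        using path(1) vwalk_append_iff[of "as @ [a]" "[b] @ c # cs" "with_proj G"] unfolding p_eq
        by auto
      have ends: "hd (as @ [a]) = u" "last (c # cs) = v"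
        using path(3,4) unfolding p_eq by (auto simp: hd_append)
      \<comment> \<open>Otherwise skipping \<open>b\<close> would give a shorter walk from
        \<open>u\<close> to \<open>v\<close>.\<close>
      have "(a, c) \<notin> parcs G"
      proof
        assume "(a, c) \<in> parcs G"
        then have "vwalk ((as @ [a]) @ c # cs) (with_proj G)"
          using walk by (subst vwalk_append_iff) auto
        then have "length p \<le> length ((as @ [a]) @ c # cs)"
          using ends by (intro shortest_path_length_le_vwalk[OF p]) (auto simp: hd_append)
        then show False by (simp add: p_eq)
      qed
      moreover have "a \<noteq> c" using path(2) by (auto simp: p_eq)
      ultimately obtain w where w: "(a, w) \<in> parcs G" "(w, c) \<in> parcs G" "w \<notin> X"
        using local walk(3,4) by blast
      \<comment> \<open>Exchanging \<open>b\<close> for \<open>w\<close> preserves the length, so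
        \<open>?q\<close> is again shortest, and in particular distinct; it meets \<open>X\<close>
        once less than \<open>p\<close>.\<close>
      let ?q = "(as @ [a]) @ w # c # cs"
      have "vwalk ?q (with_proj G)"
        using walk w by (subst vwalk_append_iff) auto
      then have "shortest_path G u ?q v"
        using ends by (intro shortest_path_vwalkI[OF p]) (auto simp: p_eq hd_append)
      then show False using min[of ?q] w(3) b(2) by (simp add: p_eq split: if_splits)
    qed
    with p show ?thesis unfolding visible_def by blast
  qed
  with sub show "total_mutual_visibility_set G X"
    by (simp add: total_mutual_visibility_set_def)
qed

theorem theorem4p2:
  fixes G :: "'a pair_pre_digraph"
  assumes "pair_graph G"
    and "Digraph_Component.connected (with_proj G)"
  shows "(\<forall>X. total_mutual_visibility_set G X \<longrightarrow> independent_set G X) \<longleftrightarrow>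
    (\<forall>u v. (u, v) \<in> parcs G \<longrightarrow>
       (middle_vertex_of_convex_P3 G u \<or> middle_vertex_of_convex_P3 G v) \<or>
       middle_edge_of_convex_diamond G u v)"
    (is "?independent \<longleftrightarrow> (\<forall>u v. _ \<longrightarrow> ?convex u v)")
proof -
  interpret pair_graph G by fact
  note tmv_iff = total_mutual_visibility_set_iff[OF assms(2)]
  have sym: "(y, x) \<in> parcs G" if "(x, y) \<in> parcs G" for x y
    using that arcs_symmetric by blast
  have irrefl: "(x, x) \<notin> parcs G" for x
    using pair_no_loops by fastforce
  show ?thesis
  proof (intro iffI allI impI)
    fix u v
    assume indep: ?independent and uv: "(u, v) \<in> parcs G"
    show "?convex u v"
    proof (rule ccontr)
      assume neg: "\<not> ?convex u v"
      \<comment> \<open>This is the local criterion for the set \<open>{u, v}\<close>, whose two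
        vertices are adjacent and which therefore contradicts \<open>indep\<close>.\<close>
      have "\<exists>w. (a, w) \<in> parcs G \<and> (w, c) \<in> parcs G \<and> w \<notin> {u, v}"
        if ac: "(a, b) \<in> parcs G" "(b, c) \<in> parcs G" "a \<noteq> c" "(a, c) \<notin> parcs G" for a b c
      proof (rule ccontr)
        assume none: "\<not> ?thesis"
        let ?N = "neighborhood G a \<inter> neighborhood G c"
        have N_iff: "x \<in> ?N \<longleftrightarrow> (a, x) \<in> parcs G \<and> (x, c) \<in> parcs G" for x
          using sym by (auto simp: neighborhood_def)
        have P3: "middle_vertex_of_convex_P3 G y" if "?N = {y}" for y
        proof -
          have "(a, y) \<in> parcs G" "(y, c) \<in> parcs G"
            using that N_iff by blast+
          then have "convex_P3 G a y c"
            using that ac(3,4) irrefl in_arcsD1 in_arcsD2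
            by (auto simp: convex_P3_def)
          then show ?thesis by (auto simp: middle_vertex_of_convex_P3_def)
        qed
        have diamond: "middle_edge_of_convex_diamond G u v" if "?N = {u, v}"
        proof -
          have "(a, u) \<in> parcs G" "(u, c) \<in> parcs G" "(a, v) \<in> parcs G" "(v, c) \<in> parcs G"
            using that N_iff by blast+
          then have "convex_diamond G a u c v"
            using that ac(3,4) uv irrefl sym
            by (auto simp: convex_diamond_def diamond_subgraph_def)
          then show ?thesis by (auto simp: middle_edge_of_convex_diamond_def)
        qed
        \<comment> \<open>The common neighbourhood lies inside \<open>{u, v}\<close> and is nonempty
          because of \<open>b\<close>, so only three cases remain, each excluded by
          \<open>neg\<close>.\<close>
        have "?N \<subseteq> {u, v}" "b \<in> ?N" using none N_iff ac by blast+
        then have "?N = {u} \<or> ?N = {v} \<or> ?N = {u, v}" by blast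
        then show False using P3 diamond neg by blast
      qed
      then have "total_mutual_visibility_set G {u, v}"
        unfolding tmv_iff using uv in_arcsD1 in_arcsD2 by blast
      then show False using indep uv by (auto simp: independent_set_def)
    qed
  next
    fix X
    assume convex: "\<forall>u v. (u, v) \<in> parcs G \<longrightarrow> ?convex u v"
      and tmv: "total_mutual_visibility_set G X"
    have outside: "\<exists>w \<in> neighborhood G a \<inter> neighborhood G c. w \<notin> X"
      if "(a, b) \<in> parcs G" "(b, c) \<in> parcs G" "a \<noteq> c" "(a, c) \<notin> parcs G" for a b c
      using tmv that sym unfolding tmv_iff neighborhood_def by blast
    \<comment> \<open>The only common neighbour of the two ends is \<open>x\<close>, so
      \<open>x\<close> itself is the witness outside \<open>X\<close>.\<close>
    have P3: "x \<notin> X" if middle: "middle_vertex_of_convex_P3 G x" for x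
    proof -
      obtain a c where "convex_P3 G a x c"
        using middle by (auto simp: middle_vertex_of_convex_P3_def)
      then show ?thesis
        using outside[of a x c] by (auto simp: convex_P3_def elim: vpathE)
    qed
    \<comment> \<open>Here the witness is one of the two ends of the middle edge, so
      \<open>X\<close> cannot contain both. Thus either alternative in \<open>convex\<close> keeps
      an edge from lying inside \<open>X\<close>.\<close>
    have diamond: "u \<notin> X \<or> v \<notin> X" if middle: "middle_edge_of_convex_diamond G u v" for u v
    proof -
      obtain a x c y where "convex_diamond G a x c y" "{u, v} = {x, y}"
        using middle by (auto simp: middle_edge_of_convex_diamond_def)
      then show ?thesis
        using outside[of a x c]
        by (auto simp: convex_diamond_def diamond_subgraph_def doubleton_eq_iff)
    qed
    have "X \<subseteq> pverts G" using tmv by (simp add: total_mutual_visibility_set_def)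
    then show "independent_set G X"
      unfolding independent_set_def using convex P3 diamond by blast
  qed
qed

end
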